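(* For all integers $n \ge m \ge 4$, \[ R(Q_m, Q_n) \le \left(m - 2 + \frac{9m - 9}{(2m - 3)(m + 1)}\right)n + m + 3. \]
   Context: $Q_k$ denotes the Boolean lattice of dimension $k$: the family of all subsets of a $k$-element ground set (e.g. $[k]=\{1,\dots,k\}$), ordered by inclusion. A subposet $Q'$ of a poset $Q$ is a copy of a poset $P$ if there is a bijection $f$ from $P$ to $Q'$ such that $x \le y$ in $P$ if and only if $f(x) \le f(y)$ in $Q$. For posets $P, P'$, the poset Ramsey number $R(P,P')$ is the smallest integer $N$ such that for every coloring of the elements of $Q_N$ in red and blue, there is a copy of $P$ all of whose elements are red or a copy of $P'$ all of whose elements are blue. *)

theory Defs
  imports Complex_Main "HOL-Library.Extended_Real"
begin

(* A poset is given by its reflexive order relation r, with carrier Field r. *)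

definition boolean_lattice :: "nat \<Rightarrow> nat set rel" where
  "boolean_lattice k = {(A, B). A \<subseteq> B \<and> B \<subseteq> {1..k}}"

lemma Field_boolean_lattice: "Field (boolean_lattice k) = Pow {1..k}"
  unfolding boolean_lattice_def Field_def by auto

lemma partial_order_on_boolean_lattice:
  "partial_order_on (Pow {1..k}) (boolean_lattice k)"
  unfolding boolean_lattice_def partial_order_on_def preorder_on_def refl_on_def trans_def antisym_def
  by auto

definition is_copy :: "'a rel \<Rightarrow> 'b rel \<Rightarrow> 'b set \<Rightarrow> bool" where
  "is_copy P Q S \<longleftrightarrow> S \<subseteq> Field Q \<and>
     (\<exists>f. bij_betw f (Field P) S \<and>
          (\<forall>x\<in>Field P. \<forall>y\<in>Field P. (x, y) \<in> P \<longleftrightarrow> (f x, f y) \<in> Q))"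

datatype colour = Red | Blue

definition ramsey_property :: "'a rel \<Rightarrow> 'b rel \<Rightarrow> nat \<Rightarrow> bool" where
  "ramsey_property P P' N \<longleftrightarrow>
     (\<forall>c :: nat set \<Rightarrow> colour.
        (\<exists>S. is_copy P (boolean_lattice N) S \<and> (\<forall>X\<in>S. c X = Red)) \<or>
        (\<exists>S. is_copy P' (boolean_lattice N) S \<and> (\<forall>X\<in>S. c X = Blue)))"

(* Valued in enat so that the infimum is \<infinity>, rather than an unspecified number,
   if no N has the property; a finite upper bound thus includes existence. *)
definition poset_ramsey :: "'a rel \<Rightarrow> 'b rel \<Rightarrow> enat" where
  "poset_ramsey P P' = Inf (enat ` {N. ramsey_property P P' N})"

end

theory Submission
  imports Defs
begin

text \<open>
  Write \<open>u\<close> for a marker element. If an interval \<open>[P, Q]\<close> contains no red sets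
  \<open>A0 \<subseteq> A1\<close> with \<open>A0\<close> and \<open>A1 \<union> {u}\<close> red, then adding \<open>u\<close> to exactly those sets that
  lie above a red set embeds the interval into the blue sets. Hence, if there is no blue copy of
  \<open>Q\<^sub>n\<close>, every interval of dimension \<open>n\<close> contains such a red pair, and a red \<open>Q\<^sub>m\<close> is built as
  \<open>Q\<^sub>m\<^sub>-\<^sub>1 \<times> Q\<^sub>1\<close> with one interval per level of \<open>Q\<^sub>m\<^sub>-\<^sub>1\<close>. The \<open>m - 2\<close> middle levels cost \<open>n\<close>
  each. If the bottom and the top level together cost more than \<open>b = \<lceil>3n/m\<rceil>\<close>, then more than
  \<open>b\<close> extreme levels of \<open>Q\<^sub>n\<close> embed into the blue sets by the same device, while each
  remaining level costs only \<open>m\<close>, because an interval of dimension \<open>m\<close> cannot be entirely red.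
  Both estimates fit into dimension \<open>m + (m - 2) n + b\<close>.
\<close>

section \<open>Embedded Boolean lattices and their transfer to copies\<close>

definition has_cube :: "'a set \<Rightarrow> nat \<Rightarrow> ('a set \<Rightarrow> bool) \<Rightarrow> bool" where
  "has_cube V k P \<longleftrightarrow> (\<exists>X f. finite (X :: 'a set) \<and> card X = k \<and>
     (\<forall>A\<subseteq>X. f A \<subseteq> V \<and> P (f A)) \<and> (\<forall>A\<subseteq>X. \<forall>B\<subseteq>X. f A \<subseteq> f B \<longleftrightarrow> A \<subseteq> B))"

text \<open>If \<open>X\<close> is kept as the trace of the embedding, inclusion of images forces
  inclusion of arguments. Only monotonicity and the colour then remain to be checked in each
  construction below.\<close>

lemma has_cubeI:
  assumes "finite X" "card X = k"
    and "\<And>A. A \<subseteq> X \<Longrightarrow> f A \<subseteq> V" "\<And>A. A \<subseteq> X \<Longrightarrow> P (f A)"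
    and trace: "\<And>A. A \<subseteq> X \<Longrightarrow> f A \<inter> X = A"
    and mono: "\<And>A B. B \<subseteq> X \<Longrightarrow> A \<subset> B \<Longrightarrow> f A \<subseteq> f B"
  shows "has_cube V k P"
  unfolding has_cube_def
proof (intro exI conjI allI impI)
  fix A B assume "A \<subseteq> X" "B \<subseteq> X"
  then show "f A \<subseteq> f B \<longleftrightarrow> A \<subseteq> B"
    using trace[of A] trace[of B] mono[of B A] by (cases "A = B") blast+
qed (use assms in auto)

text \<open>An enumeration of \<open>X\<close> by \<open>{1..k}\<close> relabels the cube, so
  constructions may use any convenient ground set \<open>X\<close>.\<close>

lemma is_copy_of_has_cube:
  assumes "has_cube {1..N} k P"
  shows "\<exists>S. is_copy (boolean_lattice k) (boolean_lattice N) S \<and> (\<forall>X\<in>S. P X)"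
proof -
  from assms obtain X f where Xf: "finite (X :: nat set) \<and> card X = k \<and>
      (\<forall>A\<subseteq>X. f A \<subseteq> {1..N} \<and> P (f A)) \<and> (\<forall>A\<subseteq>X. \<forall>B\<subseteq>X. f A \<subseteq> f B \<longleftrightarrow> A \<subseteq> B)"
    unfolding has_cube_def by (elim exE)
  then have X: "finite X" "card X = k"
    and f: "\<And>A. A \<subseteq> X \<Longrightarrow> f A \<subseteq> {1..N} \<and> P (f A)"
    and emb: "\<And>A B. A \<subseteq> X \<Longrightarrow> B \<subseteq> X \<Longrightarrow> f A \<subseteq> f B \<longleftrightarrow> A \<subseteq> B"
    by simp_all
  obtain h where h: "bij_betw h {1..k} X"
    using X ex_bij_betw_nat_finite_1 by blast
  define g where "g A = f (h ` A)" for A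
  have sub: "h ` A \<subseteq> X" if "A \<subseteq> {1..k}" for A
    using h that unfolding bij_betw_def by blast
  have g_emb: "g A \<subseteq> g B \<longleftrightarrow> A \<subseteq> B" if "A \<subseteq> {1..k}" "B \<subseteq> {1..k}" for A B
  proof -
    have "h ` A \<subseteq> h ` B \<longleftrightarrow> A \<subseteq> B"
      using inj_on_image_mem_iff[OF bij_betw_imp_inj_on[OF h]] that by blast
    then show ?thesis using emb[OF sub[OF that(1)] sub[OF that(2)]] unfolding g_def by simp
  qed
  have "inj_on g (Pow {1..k})"
    by (rule inj_onI) (metis Pow_iff g_emb subset_antisym subset_refl)
  moreover have g_in: "g A \<subseteq> {1..N} \<and> P (g A)" if "A \<subseteq> {1..k}" for A
    using f sub[OF that] unfolding g_def by blast
  ultimately have "is_copy (boolean_lattice k) (boolean_lattice N) (g ` Pow {1..k})"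
    unfolding is_copy_def Field_boolean_lattice
    by (intro conjI exI[of _ g] inj_on_imp_bij_betw) (auto simp: boolean_lattice_def g_emb)
  moreover have "\<forall>X\<in>g ` Pow {1..k}. P X" using g_in by auto
  ultimately show ?thesis by blast
qed

text \<open>List the elements of \<open>E\<close> and take initial segments of lengths
  \<open>0, k, 2k, ...\<close>. The chain supplies disjoint blocks, one for each level of a
  cube.\<close>

lemma ex_uniform_chain:
  assumes "finite E" "k * q \<le> card E"
  obtains F :: "nat \<Rightarrow> 'a set" where "mono F" "F 0 = {}"
    and "\<And>j. j \<le> q \<Longrightarrow> F j \<subseteq> E" and "\<And>j. j < q \<Longrightarrow> card (F (Suc j) - F j) = k"
proof -
  obtain h where h: "bij_betw h {0..<card E} E"
    using assms(1) ex_bij_betw_nat_finite by blast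
  define F where "F j = h ` {0..<k * j}" for j
  have le: "k * j \<le> card E" if "j \<le> q" for j
    using assms(2) that mult_le_mono2 le_trans by blast
  have "card (F (Suc j) - F j) = k" if "j < q" for j
  proof -
    have "F (Suc j) - F j = h ` ({0..<k * Suc j} - {0..<k * j})"
      unfolding F_def using h le[of "Suc j"] that
      by (intro inj_on_image_set_diff[symmetric, of _ "{0..<card E}"]) (auto simp: bij_betw_def)
    also have "card \<dots> = card ({0..<k * Suc j} - {0..<k * j})"
      by (rule card_image, rule inj_on_subset[OF bij_betw_imp_inj_on[OF h]])
        (use le[of "Suc j"] that in auto)
    also have "\<dots> = k"
      by (subst card_Diff_subset) auto
    finally show ?thesis .
  qed
  moreover have "F j \<subseteq> E" if "j \<le> q" for j
  proof -
    have "h ` {0..<k * j} \<subseteq> h ` {0..<card E}" using le[OF that] by (intro image_mono) auto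
    then show ?thesis using h unfolding F_def bij_betw_def by simp
  qed
  moreover have "mono F"
    unfolding F_def by (intro monoI image_mono) auto
  ultimately show ?thesis
    using that[of F] unfolding F_def by simp
qed

lemma if_singleton_mono:
  "(P \<Longrightarrow> Q) \<Longrightarrow> (if P then {u} else {}) \<subseteq> (if Q then {u} else {})"
  by simp

section \<open>Red pairs in intervals of a colouring without monochromatic cubes\<close>

locale cube_free_colouring =
  fixes V :: "'a set" and red :: "'a set \<Rightarrow> bool" and m n :: nat
  assumes finite_V: "finite V"
    and no_red_cube: "\<not> has_cube V m red"
    and no_blue_cube: "\<not> has_cube V n (\<lambda>A. \<not> red A)"
begin

text \<open>For \<open>u\<close> outside \<open>Q\<close> this is a red copy of
  \<open>Q\<^sub>1\<close> in direction \<open>u\<close>: \<open>A0\<close> is the end without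
  \<open>u\<close>, and \<open>A1\<close> with \<open>u\<close> added is the other end.\<close>

definition red_pair :: "'a \<Rightarrow> 'a set \<Rightarrow> 'a set \<Rightarrow> bool" where
  "red_pair u P Q \<longleftrightarrow> (\<exists>A0 A1. P \<subseteq> A0 \<and> A0 \<subseteq> A1 \<and> A1 \<subseteq> Q \<and> red A0 \<and> red (insert u A1))"

lemma red_pair_mono: "red_pair u P Q \<Longrightarrow> P' \<subseteq> P \<Longrightarrow> Q \<subseteq> Q' \<Longrightarrow> red_pair u P' Q'"
  unfolding red_pair_def by (meson order_trans)

lemma red_pair_of_card:
  assumes "P \<subseteq> Q" "insert u Q \<subseteq> V" "u \<notin> Q" "n \<le> card (Q - P)"
  shows "red_pair u P Q"
proof (rule ccontr)
  assume no: "\<not> red_pair u P Q"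
  obtain X where X: "X \<subseteq> Q - P" "card X = n" "finite X"
    using assms(4) obtain_subset_with_card_n by metis
  \<comment> \<open>Having a red set below is preserved upwards, so \<open>f\<close> is monotone. If
    such a set exists, adding \<open>u\<close> must give a blue set, as otherwise a red pair
    appears; if none exists, \<open>P \<union> A\<close> itself is blue.\<close>
  define f where "f A = P \<union> A \<union> (if \<exists>B. P \<subseteq> B \<and> B \<subseteq> P \<union> A \<and> red B then {u} else {})" for A
  have "has_cube V n (\<lambda>A. \<not> red A)"
  proof (rule has_cubeI[of X _ f])
    fix A assume A: "A \<subseteq> X"
    show "f A \<subseteq> V" "f A \<inter> X = A"
      using A X assms(1-3) by (auto simp: f_def)
    have "P \<union> A \<subseteq> Q" using A X assms(1) by blast
    then show "\<not> red (f A)"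
      using no unfolding f_def red_pair_def by auto
  next
    fix A B assume "B \<subseteq> X" "A \<subset> B"
    then show "f A \<subseteq> f B" unfolding f_def by (intro Un_mono if_singleton_mono) blast+
  qed (use X in auto)
  then show False using no_blue_cube by blast
qed

section \<open>Building a red cube level by level\<close>

text \<open>The pairs over all \<open>S\<close> combine to a red cube on \<open>insert u W\<close>:
  \<open>S\<close> is the trace on \<open>W\<close>, and \<open>u\<close> selects the end of the
  pair. The interval of \<open>S\<close> depends on \<open>H\<close> only through
  \<open>card S\<close>, so sets of equal size can share one block.\<close>

lemma no_red_pair_per_level:
  assumes "insert u (W \<union> H m) \<subseteq> V" "u \<notin> W \<union> H m" "W \<inter> H m = {}" "Suc (card W) = m"
    and H: "\<And>i j. i \<le> j \<Longrightarrow> j \<le> m \<Longrightarrow> H i \<subseteq> H j"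
    and pairs: "\<And>S. S \<subseteq> W \<Longrightarrow> red_pair u (S \<union> H (card S)) (S \<union> H (Suc (card S)))"
  shows False
proof -
  have finW: "finite W" using assms(1) finite_V finite_subset by auto
  have "\<forall>S\<in>Pow W. \<exists>p. S \<union> H (card S) \<subseteq> fst p \<and> fst p \<subseteq> snd p \<and>
      snd p \<subseteq> S \<union> H (Suc (card S)) \<and> red (fst p) \<and> red (insert u (snd p))"
    using pairs unfolding red_pair_def by simp
  from bchoice[OF this] obtain p where p:
    "\<forall>S\<in>Pow W. S \<union> H (card S) \<subseteq> fst (p S) \<and> fst (p S) \<subseteq> snd (p S) \<and>
      snd (p S) \<subseteq> S \<union> H (Suc (card S)) \<and> red (fst (p S)) \<and> red (insert u (snd (p S)))"
    by blast
  define g0 g1 where "g0 S = fst (p S)" and "g1 S = snd (p S)" for S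
  have g: "\<And>S. S \<subseteq> W \<Longrightarrow> S \<union> H (card S) \<subseteq> g0 S" "\<And>S. S \<subseteq> W \<Longrightarrow> g0 S \<subseteq> g1 S"
      "\<And>S. S \<subseteq> W \<Longrightarrow> g1 S \<subseteq> S \<union> H (Suc (card S))"
      "\<And>S. S \<subseteq> W \<Longrightarrow> red (g0 S)" "\<And>S. S \<subseteq> W \<Longrightarrow> red (insert u (g1 S))"
    using p unfolding g0_def g1_def by auto
  have up: "g1 S \<subseteq> S \<union> H m" if "S \<subseteq> W" for S
  proof -
    have "Suc (card S) \<le> m" using card_mono[OF finW that] assms(4) by simp
    then show ?thesis using g(3)[OF that] H by blast
  qed
  \<comment> \<open>Blocks of successive levels are stacked: the interval of \<open>S\<close> ends
    at or below the \<open>H\<close> part where that of \<open>T\<close> starts. Hence even the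
    upper end for \<open>S\<close> lies below the lower end for \<open>T\<close>.\<close>
  have step: "g1 S \<subseteq> g0 T" if "S \<subset> T" "T \<subseteq> W" for S T
  proof -
    have "card S < card T" using that finW finite_subset psubset_card_mono by blast
    moreover have "card T \<le> m" using card_mono[OF finW that(2)] assms(4) by simp
    ultimately have "H (Suc (card S)) \<subseteq> H (card T)" by (intro H) auto
    then show ?thesis using g(1)[of T] g(3)[of S] that by blast
  qed
  define f where "f S = (if u \<in> S then insert u (g1 (S - {u})) else g0 S)" for S
  have "has_cube V m red"
  proof (rule has_cubeI[of "insert u W" _ f])
    show "card (insert u W) = m" using assms(2,4) finW by simp
    fix S assume S: "S \<subseteq> insert u W"
    define T where "T = S - {u}"
    have T: "T \<subseteq> W" using S unfolding T_def by blast
    have g0: "T \<subseteq> g0 T" "g0 T \<subseteq> T \<union> H m" and g1: "T \<subseteq> g1 T" "g1 T \<subseteq> T \<union> H m"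
      using g(1,2)[OF T] up[OF T] by blast+
    have f: "f S = (if u \<in> S then insert u (g1 T) else g0 T)"
      and S_eq: "S = (if u \<in> S then insert u T else T)"
      unfolding f_def T_def by auto
    have "insert u (T \<union> H m) \<subseteq> V" using T assms(1) by blast
    then show "f S \<subseteq> V" using g0 g1 unfolding f by auto
    show "red (f S)" using g(4,5)[OF T] unfolding f by auto
    have "g0 T \<inter> insert u W = T" using g0 T assms(2,3) by blast
    moreover have "insert u (g1 T) \<inter> insert u W = insert u T" using g1 T assms(2,3) by blast
    ultimately show "f S \<inter> insert u W = S" using f S_eq by presburger
  next
    fix S T assume ST: "T \<subseteq> insert u W" "S \<subset> T"
    define S' T' where "S' = S - {u}" and "T' = T - {u}"
    have sub: "S' \<subseteq> W" "T' \<subseteq> W" "S' = T' \<or> S' \<subset> T'" using ST unfolding S'_def T'_def by auto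
    have "g1 S' \<subseteq> g0 T'" if "S' \<noteq> T'" using step sub that by blast
    then have le: "g0 S' \<subseteq> g0 T'" "g1 S' \<subseteq> g1 T'" "g0 S' \<subseteq> g1 T'"
      using g(2)[OF sub(1)] g(2)[OF sub(2)] by blast+
    have "f S = (if u \<in> S then insert u (g1 S') else g0 S')"
      "f T = (if u \<in> T then insert u (g1 T') else g0 T')"
      unfolding f_def S'_def T'_def by auto
    then show "f S \<subseteq> f T" using le ST by auto
  qed (use finW in auto)
  then show False using no_red_cube by blast
qed

text \<open>Otherwise \<open>G - B\<close> has room for \<open>n\<close> elements on each of the
  \<open>m - 2\<close> middle levels, where \<open>red_pair_of_card\<close> supplies pairs. With the
  two given end pairs, every level has its pairs.\<close>

lemma card_between_end_pairs:
  assumes "2 \<le> m" "insert u (W \<union> Z) \<subseteq> V" "u \<notin> W \<union> Z" "W \<inter> Z = {}" "Suc (card W) = m"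
    and "B \<subseteq> G" "G \<subseteq> Z"
    and bottom: "red_pair u {} B" and top: "red_pair u (W \<union> G) (W \<union> Z)"
  shows "card (G - B) < n * (m - 2)"
proof (rule ccontr)
  assume "\<not> card (G - B) < n * (m - 2)"
  moreover have "finite (G - B)"
    using assms(2,7) finite_V by (meson finite_Diff finite_subset le_sup_iff insert_subset)
  ultimately obtain F where F: "mono F" "F 0 = {}" "\<And>j. j \<le> m - 2 \<Longrightarrow> F j \<subseteq> G - B"
    "\<And>j. j < m - 2 \<Longrightarrow> card (F (Suc j) - F j) = n"
    using ex_uniform_chain[of "G - B" n "m - 2"] by (metis not_less)
  \<comment> \<open>Since \<open>F 0\<close> is empty, \<open>H 1 = B\<close>, which serves the
    bottom pair. The \<open>m - 2\<close> blocks of \<open>F\<close> lead to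
    \<open>H (m - 1)\<close> inside \<open>G\<close>, and the jump to \<open>Z\<close> leaves the
    top pair in the last interval.\<close>
  define H where "H j = (if j = 0 then {} else if j < m then B \<union> F (j - 1) else Z)" for j
  have H_below: "B \<union> F j \<subseteq> G" if "j \<le> m - 2" for j
    using F(3)[OF that] assms(6) by blast
  have finW: "finite W" using assms(2) finite_V finite_subset by auto
  show False
  proof (rule no_red_pair_per_level[of u W H])
    show "H i \<subseteq> H j" if "i \<le> j" "j \<le> m" for i j
    proof (cases "0 < i \<and> j < m")
      case True
      moreover have "F (i - 1) \<subseteq> F (j - 1)" using that by (intro monoD[OF F(1)]) simp
      ultimately show ?thesis using that unfolding H_def by auto
    next
      case False
      have "B \<union> F (i - 1) \<subseteq> G" if "i < m" by (rule H_below) (use that in linarith)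
      then have "H i \<subseteq> Z" using assms(7) unfolding H_def by auto
      moreover have "i = 0 \<or> j = m" using False that by linarith
      ultimately show ?thesis using assms(1) unfolding H_def by auto
    qed
    fix S assume S: "S \<subseteq> W"
    then have finS: "finite S" and le: "card S \<le> card W"
      using finW finite_subset card_mono by auto
    consider "card S = 0" | "0 < card S" "card S < card W" | "card S = card W"
      using le by linarith
    then show "red_pair u (S \<union> H (card S)) (S \<union> H (Suc (card S)))"
    proof cases
      case 1
      then have "S = {}" using finS by simp
      then show ?thesis using bottom assms(1) F(2) by (simp add: H_def)
    next
      case 2
      define j where "j = card S - 1"
      have j: "card S = Suc j" "j < m - 2" using 2 assms(5) by (auto simp: j_def)
      have eq: "H (card S) = B \<union> F j" "H (Suc (card S)) = B \<union> F (Suc j)"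
        using j by (auto simp: H_def)
      have "F (Suc j) \<subseteq> G - B" using F(3)[of "Suc j"] j by simp
      then have sub: "B \<union> F (Suc j) \<subseteq> Z" and
        diff: "(S \<union> (B \<union> F (Suc j))) - (S \<union> (B \<union> F j)) = F (Suc j) - F j"
        using S assms(4,6,7) by blast+
      show ?thesis unfolding eq
      proof (rule red_pair_of_card)
        show "S \<union> (B \<union> F j) \<subseteq> S \<union> (B \<union> F (Suc j))" using monoD[OF F(1), of j "Suc j"] by auto
        show "n \<le> card (S \<union> (B \<union> F (Suc j)) - (S \<union> (B \<union> F j)))"
          unfolding diff using F(4) j by simp
      qed (use sub S assms(2,3) in auto)
    next
      case 3
      then have "S = W" using S finW card_subset_eq by blast
      have "H (card S) \<subseteq> G" using H_below[of "card S - 1"] 3 assms(1,5) by (simp add: H_def)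
      moreover have "H (Suc (card S)) = Z" using 3 assms(5) by (simp add: H_def)
      ultimately show ?thesis unfolding \<open>S = W\<close> by (intro red_pair_mono[OF top]) auto
    qed
  qed (use assms(1-5) in \<open>auto simp: H_def\<close>)
qed

section \<open>Building a blue cube from its extreme and middle levels\<close>

lemma ex_blue_in_interval:
  assumes "P \<union> Y \<subseteq> V" "P \<inter> Y = {}" "card Y = m"
  shows "\<exists>T\<subseteq>Y. \<not> red (P \<union> T)"
proof (rule ccontr)
  assume "\<not> ?thesis"
  then have "has_cube V m red"
    using assms finite_V finite_subset
    by (intro has_cubeI[of Y _ "\<lambda>T. P \<union> T"]) (auto dest: finite_subset)
  then show False using no_red_cube by blast
qed

text \<open>Here \<open>K\<close> is the bottom piece relative to which the top pairs for the marker \<open>c\<close> are sought.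
  Two different markers are needed, as a monotone map can add each marker only once.\<close>

lemma card_bound_if_no_end_pairs:
  assumes V: "insert a (insert c (W \<union> Z)) \<subseteq> V" and a: "a \<noteq> c" "a \<notin> W \<union> Z" "c \<notin> W \<union> Z"
    and WZ: "W \<inter> Z = {}" and "K \<subseteq> Z"
    and bottom: "\<And>A. A \<subseteq> Z \<Longrightarrow> card A < h \<Longrightarrow> \<not> red_pair a {} A"
    and top: "\<And>G. K \<subseteq> G \<Longrightarrow> G \<subseteq> Z \<Longrightarrow> card (Z - G) < g \<Longrightarrow>
      \<not> red_pair c (insert a W \<union> G) (insert a W \<union> Z)"
    and levels: "n < h + g + r"
  shows "card (Z - K) < n + m * r"
proof (rule ccontr)
  assume "\<not> ?thesis"
  then have card: "n + m * r \<le> card (Z - K)" by simp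
  have finZ: "finite Z" using V finite_V finite_subset by auto
  \<comment> \<open>Avoiding \<open>K\<close> ensures
    \<open>K \<subseteq> A \<union> (Z - X)\<close>, so that \<open>top\<close> applies to the high
    levels.\<close>
  obtain X where X: "X \<subseteq> Z - K" "card X = n" "finite X"
    using card obtain_subset_with_card_n[of n "Z - K"] by auto
  have "m * r \<le> card (Z - K - X)" using X card by (simp add: card_Diff_subset)
  then obtain F where F: "mono F" "\<And>j. j \<le> r \<Longrightarrow> F j \<subseteq> Z - K - X"
    "\<And>j. j < r \<Longrightarrow> card (F (Suc j) - F j) = m"
    using ex_uniform_chain[of "Z - K - X" m r] finZ by (metis finite_Diff)
  \<comment> \<open>The marker device of \<open>red_pair_of_card\<close> over the empty set, with
    marker \<open>a\<close>. All later levels contain \<open>a\<close>, so they lie above these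
    values.\<close>
  define lo where "lo A = A \<union> (if \<exists>B\<subseteq>A. red B then {a} else {})" for A
  \<comment> \<open>The dual device: \<open>c\<close> is added when no set above the base turns red
    together with \<open>c\<close>. As \<open>A\<close> grows, fewer sets lie above, so this
    condition is monotone.\<close>
  define hi where "hi A = insert a W \<union> (A \<union> (Z - X)) \<union>
    (if \<nexists>B. insert a W \<union> (A \<union> (Z - X)) \<subseteq> B \<and> B \<subseteq> insert a W \<union> Z \<and> red (insert c B)
     then {c} else {})" for A
  \<comment> \<open>On the \<open>j\<close>-th middle level, a blue set is found between
    \<open>insert a A \<union> F j\<close> and \<open>insert a A \<union> F (Suc j)\<close>; each
    level uses up only \<open>m\<close> elements.\<close>
  have "\<exists>mid. \<forall>A\<subseteq>X. card A - h < r \<longrightarrow>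
      insert a A \<subseteq> mid A \<and> F (card A - h) \<subseteq> mid A \<and>
      mid A \<subseteq> insert a A \<union> F (Suc (card A - h)) \<and> \<not> red (mid A)"
  proof (rule choice, intro allI)
    fix A
    show "\<exists>M. A \<subseteq> X \<longrightarrow> card A - h < r \<longrightarrow> insert a A \<subseteq> M \<and> F (card A - h) \<subseteq> M \<and>
        M \<subseteq> insert a A \<union> F (Suc (card A - h)) \<and> \<not> red M"
    proof (cases "A \<subseteq> X \<and> card A - h < r")
      case True
      define j where "j = card A - h"
      have sub: "F j \<subseteq> F (Suc j)" "F (Suc j) \<subseteq> Z - K - X" "card (F (Suc j) - F j) = m"
        using True F monoD[OF F(1), of j "Suc j"] unfolding j_def by auto
      have "\<exists>T\<subseteq>F (Suc j) - F j. \<not> red (insert a A \<union> F j \<union> T)"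
        by (rule ex_blue_in_interval) (use True V a X sub in auto)
      then obtain T where "T \<subseteq> F (Suc j) - F j" "\<not> red (insert a A \<union> F j \<union> T)" by blast
      then show ?thesis using sub unfolding j_def
        by (intro exI[of _ "insert a A \<union> F (card A - h) \<union> T"]) auto
    qed blast
  qed
  then obtain mid where mid_blue: "\<And>A. A \<subseteq> X \<Longrightarrow> card A - h < r \<Longrightarrow>
      insert a A \<subseteq> mid A \<and> F (card A - h) \<subseteq> mid A \<and>
      mid A \<subseteq> insert a A \<union> F (Suc (card A - h)) \<and> \<not> red (mid A)"
    by blast
  define f where "f A = (if card A < h then lo A else if n < card A + g then hi A else mid A)" for A
  have F_sub: "F (Suc (card A - h)) \<subseteq> Z - X" if "card A - h < r" for A :: "'a set"
    using F(2)[of "Suc (card A - h)"] that by auto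
  \<comment> \<open>The sizes from \<open>h\<close> to \<open>n - g\<close> number at most
    \<open>r\<close>, so the blocks of \<open>F\<close> suffice.\<close>
  have mid_case: "card A - h < r" if "\<not> card A < h" "\<not> n < card A + g" for A :: "'a set"
    using levels that by linarith
  have "has_cube V n (\<lambda>A. \<not> red A)"
  proof (rule has_cubeI[of X _ f])
    fix A assume A: "A \<subseteq> X"
    have AZ: "A \<subseteq> Z" using A X by blast
    have "f A \<subseteq> V \<and> f A \<inter> X = A \<and> \<not> red (f A)"
    proof -
      consider (lo) "card A < h" | (hi) "\<not> card A < h" "n < card A + g"
        | (mid) "\<not> card A < h" "\<not> n < card A + g" by blast
      then show ?thesis
      proof cases
        case lo
        have "\<not> red (lo A)"
          using bottom[OF AZ lo] unfolding lo_def red_pair_def by auto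
        then show ?thesis using lo A X V a unfolding f_def lo_def by auto
      next
        case hi
        define G where "G = A \<union> (Z - X)"
        have "Z - G = X - A" using X A by (auto simp: G_def)
        then have "card (Z - G) = n - card A"
          using X card_Diff_subset[OF finite_subset[OF A X(3)] A] by simp
        then have "card (Z - G) < g"
          using hi X card_mono[OF X(3) A] by simp
        then have no: "\<not> red_pair c (insert a W \<union> G) (insert a W \<union> Z)"
          using X AZ \<open>K \<subseteq> Z\<close> by (intro top) (auto simp: G_def)
        have "G \<subseteq> Z" using AZ by (auto simp: G_def)
        have "\<not> red (hi A)"
        proof (cases "\<exists>B. insert a W \<union> G \<subseteq> B \<and> B \<subseteq> insert a W \<union> Z \<and> red (insert c B)")
          case True
          then have "hi A = insert a W \<union> G" unfolding hi_def G_def[symmetric] by simp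
          moreover have "\<not> red (insert a W \<union> G)"
            using True no unfolding red_pair_def by blast
          ultimately show ?thesis by simp
        next
          case False
          then have "hi A = insert c (insert a W \<union> G)" unfolding hi_def G_def[symmetric] by simp
          moreover have "\<not> red (insert c (insert a W \<union> G))"
            using False \<open>G \<subseteq> Z\<close> by blast
          ultimately show ?thesis by simp
        qed
        moreover have "hi A \<subseteq> V" "hi A \<inter> X = A"
          using A AZ X V a WZ unfolding hi_def by auto
        ultimately show ?thesis using hi unfolding f_def by auto
      next
        case mid
        note less = mid_case[OF mid]
        have "mid A \<subseteq> V" "mid A \<inter> X = A"
          using mid_blue[OF A less]
            F_sub[OF less] A AZ X V a by blast+
        then show ?thesis
          using mid_blue[OF A less]
            mid unfolding f_def by auto
      qed
    qed
    then show "f A \<subseteq> V" "f A \<inter> X = A" "\<not> red (f A)" by auto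
  next
    fix A B assume BX: "B \<subseteq> X" and AB: "A \<subset> B"
    then have AX: "A \<subseteq> X" by blast
    have less: "card A < card B"
      by (rule psubset_card_mono[OF finite_subset[OF BX X(3)] AB])
    have loA: "lo A \<subseteq> insert a A" by (auto simp: lo_def)
    have hiB: "insert a B \<union> (Z - X) \<subseteq> hi B" by (auto simp: hi_def)
    consider (lo) "card A < h" "card B < h" | (hi) "\<not> card A < h" "n < card A + g"
      | (lo_hi) "card A < h" "\<not> card B < h" "n < card B + g"
      | (lo_mid) "card A < h" "\<not> card B < h" "\<not> n < card B + g"
      | (mid_hi) "\<not> card A < h" "\<not> n < card A + g" "n < card B + g"
      | (mid) "\<not> card A < h" "\<not> n < card A + g" "\<not> n < card B + g"
      by linarith
    then show "f A \<subseteq> f B"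
    proof cases
      case lo
      have "lo A \<subseteq> lo B" using AB unfolding lo_def by (intro Un_mono if_singleton_mono) blast+
      then show ?thesis using lo by (simp add: f_def)
    next
      case hi
      have "insert a W \<union> (A \<union> (Z - X)) \<subseteq> insert a W \<union> (B \<union> (Z - X))" using AB by blast
      then have "hi A \<subseteq> hi B"
        unfolding hi_def by (rule Un_mono, intro if_singleton_mono) (meson order_trans)
      then show ?thesis using hi less by (simp add: f_def)
    next
      case lo_hi
      have "lo A \<subseteq> hi B" using loA hiB AB by blast
      then show ?thesis using lo_hi by (simp add: f_def)
    next
      case lo_mid
      have "insert a B \<subseteq> mid B" using mid_blue[OF BX mid_case[OF lo_mid(2,3)]] by blast
      then have "lo A \<subseteq> mid B" using loA AB by blast
      then show ?thesis using lo_mid by (simp add: f_def)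
    next
      case mid_hi
      note less_r = mid_case[OF mid_hi(1,2)]
      have "mid A \<subseteq> hi B" using mid_blue[OF AX less_r] F_sub[OF less_r] hiB AB by blast
      then show ?thesis using mid_hi less by (simp add: f_def)
    next
      case mid
      note less_r = mid_case[OF mid(1,2)]
      have B: "\<not> card B < h" using mid(1) less by simp
      have "F (Suc (card A - h)) \<subseteq> F (card B - h)"
        using less mid(1) by (intro monoD[OF F(1)]) linarith
      then have "mid A \<subseteq> mid B"
        using mid_blue[OF AX less_r] mid_blue[OF BX mid_case[OF B mid(3)]] AB by blast
      then show ?thesis using mid B by (simp add: f_def)
    qed
  qed (use X in auto)
  then show False using no_blue_cube by blast
qed

section \<open>Balancing the two constructions\<close>

text \<open>Choose the smallest bottom piece \<open>K\<close> with a pair, then the largest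
  \<open>G\<close> above it with a top pair. By \<open>card_between_end_pairs\<close> less than
  \<open>n * (m - 2)\<close> elements lie between, so the two ends use more than \<open>b\<close>
  elements, and minimality excludes pairs in smaller ends.\<close>

lemma ex_end_pairs:
  assumes "2 \<le> m" "insert u (W \<union> Z) \<subseteq> V" "u \<notin> W \<union> Z" "W \<inter> Z = {}" "Suc (card W) = m"
    and "n * (m - 2) + b = card Z" "b + n \<le> card Z"
  obtains (large) "\<And>A. A \<subseteq> Z \<Longrightarrow> card A \<le> b \<Longrightarrow> \<not> red_pair u {} A"
  | (small) K g where "K \<subseteq> Z" "card K \<le> b" "b < card K + g"
      "\<And>A. A \<subseteq> Z \<Longrightarrow> card A < card K \<Longrightarrow> \<not> red_pair u {} A"
      "\<And>G. K \<subseteq> G \<Longrightarrow> G \<subseteq> Z \<Longrightarrow> card (Z - G) < g \<Longrightarrow> \<not> red_pair u (W \<union> G) (W \<union> Z)"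
proof (cases "\<exists>A\<subseteq>Z. card A \<le> b \<and> red_pair u {} A")
  case False
  then show ?thesis using large by blast
next
  case True
  have finZ: "finite Z" using assms(2) finite_V finite_subset by auto
  from True obtain A0 where "A0 \<subseteq> Z \<and> card A0 \<le> b \<and> red_pair u {} A0" by blast
  from ex_has_least_nat[of "\<lambda>A. A \<subseteq> Z \<and> card A \<le> b \<and> red_pair u {} A", OF this, of card]
  obtain K where K_least: "(K \<subseteq> Z \<and> card K \<le> b \<and> red_pair u {} K) \<and>
      (\<forall>A. A \<subseteq> Z \<and> card A \<le> b \<and> red_pair u {} A \<longrightarrow> card K \<le> card A)" ..
  then have K: "K \<subseteq> Z" "card K \<le> b" "red_pair u {} K"
    and K_min: "\<And>A. A \<subseteq> Z \<Longrightarrow> card A \<le> b \<Longrightarrow> red_pair u {} A \<Longrightarrow> card K \<le> card A"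
    by simp_all
  have finK: "finite K" using K(1) finZ finite_subset by blast
  \<comment> \<open>The search for \<open>G\<close> can start at \<open>K\<close>: at least
    \<open>n\<close> elements of \<open>Z\<close> remain outside it.\<close>
  have top: "red_pair u (W \<union> K) (W \<union> Z)"
  proof (rule red_pair_of_card)
    have "W \<union> Z - (W \<union> K) = Z - K" using assms(4) by blast
    then show "n \<le> card (W \<union> Z - (W \<union> K))"
      using K finK assms(7) by (simp add: card_Diff_subset)
  qed (use K assms in auto)
  have "K \<subseteq> K \<and> K \<subseteq> Z \<and> red_pair u (W \<union> K) (W \<union> Z)" using top K(1) by blast
  from ex_has_least_nat[of "\<lambda>G. K \<subseteq> G \<and> G \<subseteq> Z \<and> red_pair u (W \<union> G) (W \<union> Z)", OF this,
      of "\<lambda>G. card (Z - G)"]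
  obtain G where G_least: "(K \<subseteq> G \<and> G \<subseteq> Z \<and> red_pair u (W \<union> G) (W \<union> Z)) \<and>
      (\<forall>G'. K \<subseteq> G' \<and> G' \<subseteq> Z \<and> red_pair u (W \<union> G') (W \<union> Z) \<longrightarrow> card (Z - G) \<le> card (Z - G'))" ..
  then have G: "K \<subseteq> G" "G \<subseteq> Z" "red_pair u (W \<union> G) (W \<union> Z)"
    and G_min: "\<And>G'. K \<subseteq> G' \<Longrightarrow> G' \<subseteq> Z \<Longrightarrow> red_pair u (W \<union> G') (W \<union> Z) \<Longrightarrow>
      card (Z - G) \<le> card (Z - G')"
    by simp_all
  have finG: "finite G" using G(2) finZ finite_subset by blast
  have "card (G - K) < n * (m - 2)"
    by (rule card_between_end_pairs[OF assms(1-5) G(1,2) K(3) G(3)])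
  then have "b < card K + card (Z - G)"
    using assms(6) G finK finG card_mono[OF finZ G(2)] by (simp add: card_Diff_subset)
  then show ?thesis
  proof (rule small[OF K(1,2)])
    show "\<not> red_pair u {} A" if "A \<subseteq> Z" "card A < card K" for A
      using K_min[OF that(1)] K(2) that(2) by linarith
    show "\<not> red_pair u (W \<union> G') (W \<union> Z)"
      if "K \<subseteq> G'" "G' \<subseteq> Z" "card (Z - G') < card (Z - G)" for G'
      using G_min[OF that(1,2)] that(3) by linarith
  qed
qed

text \<open>The end analysis is run for both markers \<open>a\<close> and \<open>c\<close>, each
  time with the other one added to \<open>W\<close>. A bottom end for one marker and a top end for
  the other then give a blue cube that is too large for the colouring.\<close>

lemma card_V_less:
  assumes "3 \<le> m" "3 * n \<le> m * b"
  shows "card V < m + n * (m - 2) + b"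
proof (rule ccontr)
  assume "\<not> ?thesis"
  then obtain V' where V': "V' \<subseteq> V" "card V' = m + n * (m - 2) + b" "finite V'"
    using obtain_subset_with_card_n[of "m + n * (m - 2) + b" V] by auto
  then obtain U where U: "U \<subseteq> V'" "card U = m" "finite U"
    using obtain_subset_with_card_n[of m V'] by auto
  obtain U' where U': "U' \<subseteq> U" "card U' = 2"
    by (rule obtain_subset_with_card_n[of 2 U]) (use U(2) assms(1) in simp_all)
  obtain a c where ac: "U' = {a, c}" "a \<noteq> c" using U'(2) card_2_iff by metis
  define W where "W = U - {a, c}"
  define Z where "Z = V' - U"
  have U_eq: "U = insert a (insert c W)" and disj: "a \<notin> W" "c \<notin> W" "W \<inter> Z = {}" "a \<notin> Z" "c \<notin> Z"
    and sub: "insert a (insert c (W \<union> Z)) \<subseteq> V"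
    using U' ac U V' unfolding W_def Z_def by auto
  have finW: "finite W" using U unfolding W_def by simp
  have cardW: "Suc (Suc (card W)) = m"
    using U U_eq disj ac finW by simp
  have cardZ: "n * (m - 2) + b = card Z"
    using U V' unfolding Z_def by (simp add: card_Diff_subset)
  have finZ: "finite Z" using V' unfolding Z_def by simp
  have "n * 1 \<le> n * (m - 2)" using assms(1) by (intro mult_le_mono2) simp
  then have n_le: "n \<le> n * (m - 2)" by (simp only: mult_1_right)
  then have bn: "b + n \<le> card Z" using cardZ by linarith
  \<comment> \<open>This is where \<open>3 * n \<le> m * b\<close> enters: for
    \<open>b \<le> n\<close> the claim amounts exactly to it. For \<open>b > n\<close> the truncated
    difference is zero.\<close>
  have room: "n + m * (n - b) \<le> n * (m - 2)"
  proof (cases "b \<le> n")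
    case True
    then have "m * (n - b) + m * b = m * n" by (metis add_mult_distrib2 le_add_diff_inverse2)
    moreover have "n * (m - 2) + n * 2 = m * n"
    proof -
      have "m - 2 + 2 = m" using assms(1) by linarith
      then show ?thesis by (metis add_mult_distrib2 mult.commute)
    qed
    ultimately show ?thesis using assms(2) by linarith
  next
    case False
    then have "n - b = 0" by simp
    then show ?thesis using n_le by (simp only: mult_0_right add_0_right)
  qed
  \<comment> \<open>More than \<open>b\<close> extreme levels are free of pairs, so
    \<open>n - b\<close> middle levels suffice.\<close>
  have contra: False
    if uv: "{u, v} = {a, c}" "u \<noteq> v" and K: "K \<subseteq> Z" "card K \<le> b"
      and h: "\<And>A. A \<subseteq> Z \<Longrightarrow> card A < h \<Longrightarrow> \<not> red_pair u {} A"
      and g: "\<And>G. K \<subseteq> G \<Longrightarrow> G \<subseteq> Z \<Longrightarrow> card (Z - G) < g \<Longrightarrow>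
        \<not> red_pair v (insert u W \<union> G) (insert u W \<union> Z)"
      and hg: "b < h + g" for u v K h g
  proof -
    have "insert u (insert v (W \<union> Z)) \<subseteq> V" "u \<notin> W \<union> Z" "v \<notin> W \<union> Z"
      using uv(1) sub disj by (auto simp: doubleton_eq_iff)
    moreover have "n < h + g + (n - b)" using hg by linarith
    ultimately have "card (Z - K) < n + m * (n - b)"
      using card_bound_if_no_end_pairs[OF _ uv(2) _ _ disj(3) K(1) h g] by blast
    moreover have "n * (m - 2) \<le> card (Z - K)"
      using K finite_subset[OF K(1) finZ] cardZ by (simp add: card_Diff_subset)
    ultimately show False using room by simp
  qed
  \<comment> \<open>Here the \<open>b + 1\<close> lowest levels are already enough, without any top
    level.\<close>
  have large: False
    if "{u, v} = {a, c}" "u \<noteq> v" "\<And>A. A \<subseteq> Z \<Longrightarrow> card A \<le> b \<Longrightarrow> \<not> red_pair u {} A" for u v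
    by (rule contra[OF that(1,2), of "{}" "Suc b" 0]) (simp_all add: that(3))
  show False
  proof (rule ex_end_pairs[of a "insert c W" Z b])
    fix K g
    assume K: "K \<subseteq> Z" "card K \<le> b" "b < card K + g"
      "\<And>A. A \<subseteq> Z \<Longrightarrow> card A < card K \<Longrightarrow> \<not> red_pair a {} A"
      "\<And>G. K \<subseteq> G \<Longrightarrow> G \<subseteq> Z \<Longrightarrow> card (Z - G) < g \<Longrightarrow>
        \<not> red_pair a (insert c W \<union> G) (insert c W \<union> Z)"
    show False
    proof (rule ex_end_pairs[of c "insert a W" Z b])
      fix L k
      assume L: "L \<subseteq> Z" "card L \<le> b" "b < card L + k"
        "\<And>A. A \<subseteq> Z \<Longrightarrow> card A < card L \<Longrightarrow> \<not> red_pair c {} A"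
        "\<And>G. L \<subseteq> G \<Longrightarrow> G \<subseteq> Z \<Longrightarrow> card (Z - G) < k \<Longrightarrow>
          \<not> red_pair c (insert a W \<union> G) (insert a W \<union> Z)"
      \<comment> \<open>The two sums \<open>card K + g\<close> and \<open>card L + k\<close> both
        exceed \<open>b\<close>. Exchanging their top parts preserves the total, so one of the mixed
        sums exceeds \<open>b\<close> too, and it uses two different markers.\<close>
      consider "b < card K + k" | "b < card L + g" using K(3) L(3) by linarith
      then show False
      proof cases
        case 1
        then show False by (intro contra[OF _ ac(2) L(1,2) K(4) L(5)]) auto
      next
        case 2
        then show False by (intro contra[OF _ ac(2)[symmetric] K(1,2) L(4) K(5)]) auto
      qed
    next
      assume "\<And>A. A \<subseteq> Z \<Longrightarrow> card A \<le> b \<Longrightarrow> \<not> red_pair c {} A"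
      then show False by (intro large[OF _ ac(2)[symmetric]]) auto
    qed (use assms sub disj ac cardW cardZ bn finW in auto)
  next
    assume "\<And>A. A \<subseteq> Z \<Longrightarrow> card A \<le> b \<Longrightarrow> \<not> red_pair a {} A"
    then show False by (intro large[OF _ ac(2)]) auto
  qed (use assms sub disj ac cardW cardZ bn finW in auto)
qed

end

section \<open>The Ramsey property and the numerical bound\<close>

lemma ramsey_property_boolean_lattice:
  assumes "3 \<le> m" "3 * n \<le> m * b"
  shows "ramsey_property (boolean_lattice m) (boolean_lattice n) (m + n * (m - 2) + b)"
  unfolding ramsey_property_def
proof (intro allI)
  fix c :: "nat set \<Rightarrow> colour"
  let ?N = "m + n * (m - 2) + b"
  have "has_cube {1..?N} m (\<lambda>A. c A = Red) \<or> has_cube {1..?N} n (\<lambda>A. \<not> c A = Red)"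
  proof (rule ccontr)
    assume "\<not> ?thesis"
    then interpret cube_free_colouring "{1..?N}" "\<lambda>A. c A = Red" m n
      by unfold_locales auto
    show False using card_V_less[OF assms] by simp
  qed
  moreover have "\<not> c A = Red \<longleftrightarrow> c A = Blue" for A by (cases "c A") auto
  ultimately show "(\<exists>S. is_copy (boolean_lattice m) (boolean_lattice ?N) S \<and> (\<forall>X\<in>S. c X = Red)) \<or>
      (\<exists>S. is_copy (boolean_lattice n) (boolean_lattice ?N) S \<and> (\<forall>X\<in>S. c X = Blue))"
    using is_copy_of_has_cube[of ?N m "\<lambda>A. c A = Red"]
      is_copy_of_has_cube[of ?N n "\<lambda>A. c A = Blue"] by auto
qed

theorem theorem7:
  fixes m n :: nat
  assumes "4 \<le> m" and "m \<le> n"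
  shows "ereal_of_enat (poset_ramsey (boolean_lattice m) (boolean_lattice n))
    \<le> ereal ((real m - 2 + (9 * real m - 9) / ((2 * real m - 3) * (real m + 1))) * real n
              + real m + 3)"
proof -
  \<comment> \<open>The least integer with \<open>3 * n \<le> m * b\<close>.\<close>
  define b where "b = nat \<lceil>3 * real n / real m\<rceil>"
  define N where "N = m + n * (m - 2) + b"
  have m: "4 \<le> real m" using assms(1) by simp
  have b: "3 * real n / real m \<le> real b" "real b \<le> 3 * real n / real m + 1"
  proof -
    have "real b = of_int \<lceil>3 * real n / real m\<rceil>" unfolding b_def by simp
    then show "3 * real n / real m \<le> real b" "real b \<le> 3 * real n / real m + 1"
      by linarith+
  qed
  have "3 * real n \<le> real m * real b" using b(1) m by (simp add: field_simps)
  then have "3 * n \<le> m * b"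
    by (metis of_nat_le_iff of_nat_mult of_nat_numeral)
  then have "ramsey_property (boolean_lattice m) (boolean_lattice n) N"
    unfolding N_def using assms(1) by (intro ramsey_property_boolean_lattice) auto
  then have "poset_ramsey (boolean_lattice m) (boolean_lattice n) \<le> enat N"
    unfolding poset_ramsey_def by (intro Inf_lower) auto
  then have "ereal_of_enat (poset_ramsey (boolean_lattice m) (boolean_lattice n)) \<le> ereal (real N)"
    by (metis ereal_of_enat_le_iff ereal_of_enat_simps(1))
  also have "real N \<le> (real m - 2 + (9 * real m - 9) / ((2 * real m - 3) * (real m + 1))) * real n
              + real m + 3"
  proof -
    \<comment> \<open>After clearing denominators, the claim that \<open>3 / m\<close> is at most
      the stated fraction has slack \<open>3 * (m - 1)\<^sup>2 + 6\<close>.\<close>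
    have "0 \<le> (real m - 1)\<^sup>2" by simp
    then have "3 * ((2 * real m - 3) * (real m + 1)) \<le> (9 * real m - 9) * real m"
      by (simp add: algebra_simps power2_eq_square)
    moreover have "0 < (2 * real m - 3) * (real m + 1)" using m by simp
    ultimately have "3 / real m \<le> (9 * real m - 9) / ((2 * real m - 3) * (real m + 1))"
      using m by (simp add: divide_le_eq le_divide_eq frac_le_eq field_simps)
    then have "3 / real m * real n \<le> (9 * real m - 9) / ((2 * real m - 3) * (real m + 1)) * real n"
      by (intro mult_right_mono) auto
    then have "real b \<le> (9 * real m - 9) / ((2 * real m - 3) * (real m + 1)) * real n + 1"
      using b(2) by simp
    moreover have "real N = real m + real n * (real m - 2) + real b"
      unfolding N_def using assms(1) by (simp add: of_nat_diff)
    \<comment> \<open>Rounding up in \<open>b\<close> costs at most 1 of the additive 3.\<close>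
    ultimately show ?thesis by (simp add: algebra_simps)
  qed
  finally show ?thesis by simp
qed

end
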